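(* Let $p\ge 1$ and let $0\le\delta<\min\{\hat\delta,\delta_\gamma\}$ (for all sufficiently large $\gamma$). Let $y_\gamma\in K$ be the unique solution in $K$ of $$[(1+\delta y^p(x))y'(x)]'+2xy'(x)=0,\ 0<x<+\infty,\qquad (1+\delta y^p(0))\,y'(0)-\gamma y(0)=0,\qquad y(+\infty)=1,$$ and let $y^*\in K$ be the unique solution in $K$ of $$[(1+\delta y^p(x))y'(x)]'+2xy'(x)=0,\ 0<x<+\infty,\qquad y(0)=0,\qquad y(+\infty)=1.$$ Then $\|y_\gamma-y^*\|_\infty\to 0$ as $\gamma\to\infty$. Furthermore, the order of convergence is $\frac1\gamma$ as $\gamma\to\infty$, i.e. $\|y_\gamma-y^*\|_\infty=O(1/\gamma)$.
   Context: $\mathbb{R}_0^+=[0,\infty)$. $X$ is the set of continuous bounded functions $h:\mathbb{R}_0^+\to\mathbb{R}$, with $\|h\|_\infty=\sup_{x\in\mathbb{R}_0^+}|h(x)|$, and $K=\{h\in X : \|h\|_\infty\le 1,\ 0\le h,\ h(+\infty)=1\}$, where $h(+\infty)=\lim_{x\to\infty}h(x)$. The notation $y^p(x)$ means $(y(x))^p$. Solutions are understood in the classical sense (with the one-sided derivative at $x=0$ where it appears). $\hat\delta>0$ is the unique positive number with $C(\hat\delta)=1$, where $C(x)=2xp(1+x)^3(2+x)$, $x\ge0$. For $\gamma>0$, $\delta_\gamma>0$ is the unique positive number with $g_\gamma(\delta_\gamma)=1$, where $$g_\gamma(x)=xp(1+x)^{3/2}\left[(2+x)\left(1+(1+x)^{3/2}\right)+\frac{2}{\gamma\sqrt{\pi}}(1+x)\right],\qquad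 x\ge 0.$$ For $0\le\delta<\delta_\gamma$ the first problem has a unique solution $y_\gamma$ in $K$, and the second problem has a unique solution $y^*$ in $K$. *)

theory Defs
  imports "HOL-Analysis.Analysis" "HOL-Library.Landau_Symbols"
begin

text \<open>
  Functions on the half-line $[0,\infty)$ are functions on all reals of which only the values
  on \<open>{0..}\<close> are used.
\<close>

definition sup_norm :: "(real \<Rightarrow> real) \<Rightarrow> real" where
  "sup_norm h = (SUP x\<in>{0..}. \<bar>h x\<bar>)"

definition X_space :: "(real \<Rightarrow> real) set" where
  "X_space = {h. continuous_on {0..} h \<and> bounded (h ` {0..})}"

definition K_set :: "(real \<Rightarrow> real) set" where
  "K_set = {h \<in> X_space. sup_norm h \<le> 1 \<and> (\<forall>x\<ge>0. 0 \<le> h x) \<and> (h \<longlongrightarrow> 1) at_top}"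

text \<open>
  Classical form of $[(1 + \delta y^p) y']' + 2 x y' = 0$ on $(0,\infty)$, where \<open>y'\<close> is the
  derivative of \<open>y\<close>.
  Since $y \ge 0$ in \<open>K_set\<close> and $p \ge 1$, the power is \<open>powr\<close>, with $0^p = 0$.
\<close>

definition solves_ode :: "real \<Rightarrow> real \<Rightarrow> (real \<Rightarrow> real) \<Rightarrow> (real \<Rightarrow> real) \<Rightarrow> bool" where
  "solves_ode p \<delta> y y' \<longleftrightarrow>
     (\<forall>x>0. (y has_real_derivative y' x) (at x) \<and>
        (\<exists>d. ((\<lambda>s. (1 + \<delta> * y s powr p) * y' s) has_real_derivative d) (at x) \<and>
             d + 2 * x * y' x = 0))"

definition robin_solution :: "real \<Rightarrow> real \<Rightarrow> real \<Rightarrow> (real \<Rightarrow> real) \<Rightarrow> bool" where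
  "robin_solution p \<delta> \<gamma> y \<longleftrightarrow>
     (\<exists>y'. solves_ode p \<delta> y y' \<and>
        (y has_real_derivative y' 0) (at 0 within {0..}) \<and>
        (1 + \<delta> * y 0 powr p) * y' 0 - \<gamma> * y 0 = 0) \<and>
     (y \<longlongrightarrow> 1) at_top"

definition dirichlet_solution :: "real \<Rightarrow> real \<Rightarrow> (real \<Rightarrow> real) \<Rightarrow> bool" where
  "dirichlet_solution p \<delta> y \<longleftrightarrow>
     (\<exists>y'. solves_ode p \<delta> y y') \<and> y 0 = 0 \<and> (y \<longlongrightarrow> 1) at_top"

definition C_fun :: "real \<Rightarrow> real \<Rightarrow> real" where
  "C_fun p x = 2 * x * p * (1 + x) ^ 3 * (2 + x)"

definition g_fun :: "real \<Rightarrow> real \<Rightarrow> real \<Rightarrow> real" where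
  "g_fun p \<gamma> x = x * p * (1 + x) powr (3/2) *
     ((2 + x) * (1 + (1 + x) powr (3/2)) + 2 / (\<gamma> * sqrt pi) * (1 + x))"

definition delta_hat :: "real \<Rightarrow> real" where
  "delta_hat p = (THE x. 0 < x \<and> C_fun p x = 1)"

definition delta_gamma :: "real \<Rightarrow> real \<Rightarrow> real" where
  "delta_gamma p \<gamma> = (THE x. 0 < x \<and> g_fun p \<gamma> x = 1)"

text \<open>The two descriptions above are proper.\<close>

lemma ex1_root:
  fixes f q :: "real \<Rightarrow> real"
  assumes f: "\<And>x. f x = x * q x"
    and cont: "continuous_on {0..} q"
    and mono: "\<And>x y. 0 \<le> x \<Longrightarrow> x \<le> y \<Longrightarrow> q x \<le> q y"
    and ge: "1 \<le> q 0"
  shows "\<exists>!x. 0 < x \<and> f x = 1"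
proof -
  have q1: "1 \<le> q x" if "0 \<le> x" for x
    using mono[of 0 x] ge that by simp
  have "continuous_on {0..1} f"
    unfolding f by (intro continuous_intros continuous_on_subset[OF cont]) auto
  then obtain x where x: "0 \<le> x" "x \<le> 1" "f x = 1"
    using IVT'[of f 0 1 1] q1[of 1] by (auto simp: f)
  have "0 < x"
    using x by (cases "x = 0") (auto simp: f)
  moreover have strict: "f a < f b" if "0 < a" "a < b" for a b
  proof -
    have "a * q a < b * q a" using that q1[of a] by simp
    also have "b * q a \<le> b * q b" using mono[of a b] that by simp
    finally show ?thesis by (simp add: f)
  qed
  ultimately show ?thesis
    using x by (intro ex1I[of _ x]) (auto, metis less_irrefl linorder_neqE)
qed

lemma ex1_delta_hat:
  assumes "1 \<le> p"
  shows "\<exists>!x. 0 < x \<and> C_fun p x = 1"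
proof (rule ex1_root)
  show "C_fun p x = x * (2 * p * (1 + x) ^ 3 * (2 + x))" for x
    by (simp add: C_fun_def)
  show "continuous_on {0..} (\<lambda>x. 2 * p * (1 + x) ^ 3 * (2 + x))"
    by (intro continuous_intros)
  show "2 * p * (1 + x) ^ 3 * (2 + x) \<le> 2 * p * (1 + y) ^ 3 * (2 + y)"
    if "0 \<le> x" "x \<le> y" for x y
    using that assms by (intro mult_mono mult_nonneg_nonneg power_mono) auto
qed (use assms in auto)

lemma ex1_delta_gamma:
  assumes "1 \<le> p" "0 < \<gamma>"
  shows "\<exists>!x. 0 < x \<and> g_fun p \<gamma> x = 1"
proof (rule ex1_root)
  let ?q = "\<lambda>x. p * (1 + x) powr (3/2) *
     ((2 + x) * (1 + (1 + x) powr (3/2)) + 2 / (\<gamma> * sqrt pi) * (1 + x))"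
  show "g_fun p \<gamma> x = x * ?q x" for x
    by (simp add: g_fun_def)
  show "continuous_on {0..} ?q"
    by (intro continuous_intros) auto
  show "?q x \<le> ?q y" if "0 \<le> x" "x \<le> y" for x y
    using that assms
    by (intro mult_mono mult_nonneg_nonneg add_mono add_nonneg_nonneg powr_mono2) auto
  have "1 * 1 \<le> p * (4 + 2 / (\<gamma> * sqrt pi))"
    using assms by (intro mult_mono) (auto intro: add_increasing2)
  then show "1 \<le> ?q 0" by simp
qed

end

theory Submission
  imports Defs
begin

text \<open>
  Let $a(u) = 1 + \delta u^p$, $G(u) = \int_0^u a$, and let $w = a(y) y' = (G \circ y)'$ be the flux
  of a solution, so that $w' = -2 x w / a(y)$.  For two solutions $y_1, y_2$ with fluxes
  $w_1, w_2$, a point $c > 0$ with $y_1(c) < y_2(c)$ and $w_1(c) \le w_2(c)$ cannot exist: since $a$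
  is nondecreasing, $w_2$ decays no faster than $w_1$ as long as $y_1 \le y_2$, so $G(y_2) - G(y_1)$
  would be nondecreasing on $[c,\infty)$ although it tends to $0$.  Hence $G(y_2) - G(y_1)$
  decreases wherever it is positive and is bounded by its value at $0$ or by $0$.  As $G' \ge 1$,
  this gives $\|y_\gamma - y^*\|_\infty \le G(y_\gamma(0))$.  The total variation of $y_\gamma$ on
  $[0,1]$ is at most $1$, which bounds the flux independently of $\gamma$, and the Robin condition
  then yields $y_\gamma(0) = O(1/\gamma)$.
\<close>

section \<open>Diffusivity, its primitive and solution profiles\<close>

text \<open>All conditions concern [0,1] only, the range of members of \<open>K_set\<close>.
  Monotonicity drives the comparison; the lower bound 1 makes the primitive expanding.\<close>

locale diffusivity =
  fixes a :: "real \<Rightarrow> real"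
  assumes cont: "continuous_on {0..1} a"
    and mono: "\<And>s t. 0 \<le> s \<Longrightarrow> s \<le> t \<Longrightarrow> t \<le> 1 \<Longrightarrow> a s \<le> a t"
    and ge1: "\<And>t. 0 \<le> t \<Longrightarrow> t \<le> 1 \<Longrightarrow> 1 \<le> a t"
begin

definition G :: "real \<Rightarrow> real" where
  "G t = integral {0..t} a"

text \<open>The second-order equation as a first-order system in \<open>y\<close> and its flux
  \<open>w\<close>. Nothing but continuity of \<open>y\<close> is asked at 0, so Robin and Dirichlet
  solutions both fit.\<close>

definition profile :: "(real \<Rightarrow> real) \<Rightarrow> (real \<Rightarrow> real) \<Rightarrow> bool" where
  "profile y w \<longleftrightarrow> continuous_on {0..} y \<and> (\<forall>x\<ge>0. 0 \<le> y x \<and> y x \<le> 1) \<and> (y \<longlongrightarrow> 1) at_top \<and>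
     (\<forall>x>0. (y has_real_derivative w x / a (y x)) (at x) \<and>
            (w has_real_derivative - (2 * x / a (y x)) * w x) (at x))"

text \<open>Exponent of the integrating factor for the flux equation, which is linear in
  \<open>w\<close> once \<open>y\<close> is fixed.\<close>

definition A :: "(real \<Rightarrow> real) \<Rightarrow> real \<Rightarrow> real" where
  "A y x = integral {0..x} (\<lambda>s. 2 * s / a (y s))"

lemma G_deriv:
  assumes "t \<in> {0..1}"
  shows "(G has_real_derivative a t) (at t within {0..1})"
  unfolding G_def by (rule integral_has_real_derivative[OF cont assms])

text \<open>Mean value theorem with 1 \<le> \<open>a\<close> \<le> \<open>a 1\<close> on [0,1]. The
  two bounds translate between gaps of values and gaps of \<open>G\<close>.\<close>

lemma G_diff:
  assumes "0 \<le> s" "s \<le> t" "t \<le> 1"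
  shows "t - s \<le> G t - G s" "G t - G s \<le> a 1 * (t - s)"
proof -
  have D: "(G has_real_derivative a x) (at x within {s..t})" if "s \<le> x" "x \<le> t" for x
    by (rule DERIV_subset[OF G_deriv]) (use that assms in auto)
  have "\<exists>x\<in>{s..t}. G t - G s = a x * (t - s)"
    using assms D by (intro mvt_very_simple) (auto simp: has_field_derivative_def)
  then obtain x where x: "s \<le> x" "x \<le> t" "G t - G s = a x * (t - s)" by auto
  have "1 \<le> a x" "a x \<le> a 1" using ge1[of x] mono[of x 1] x assms by auto
  then have "1 * (t - s) \<le> a x * (t - s)" "a x * (t - s) \<le> a 1 * (t - s)"
    using assms by (intro mult_right_mono; simp)+
  then show "t - s \<le> G t - G s" "G t - G s \<le> a 1 * (t - s)" using x by auto
qed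

lemma profileD:
  assumes "profile y w" "0 \<le> x"
  shows "0 \<le> y x" "y x \<le> 1" "1 \<le> a (y x)" "a (y x) \<le> a 1"
  using assms ge1 mono[of "y x" 1] by (auto simp: profile_def)

lemma profile_deriv:
  assumes "profile y w" "0 < x"
  shows "(y has_real_derivative w x / a (y x)) (at x)"
    and "(w has_real_derivative - (2 * x / a (y x)) * w x) (at x)"
  using assms by (auto simp: profile_def)

lemma A_deriv:
  assumes P: "profile y w" and "0 < x"
  shows "(A y has_real_derivative 2 * x / a (y x)) (at x)"
proof -
  have "continuous_on {0..x+1} (\<lambda>s. a (y s))"
    by (rule continuous_on_compose2[OF cont])
      (use P in \<open>auto simp: profile_def intro: continuous_on_subset\<close>)
  then have "continuous_on {0..x+1} (\<lambda>s. 2 * s / a (y s))"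
    using profileD(3)[OF P] by (intro continuous_intros) force+
  then have "(A y has_real_derivative 2 * x / a (y x)) (at x within {0..x+1})"
    unfolding A_def by (rule integral_has_real_derivative) (use assms in auto)
  then show ?thesis
    using assms at_within_Icc_at[of 0 x "x+1"] by simp
qed

section \<open>The flux: explicit form, sign, and relation to \<open>G\<close>\<close>

text \<open>The product \<open>w x * exp (A y x)\<close> has derivative zero on the open half-line.
  In particular \<open>w\<close> has constant sign.\<close>

lemma flux_formula:
  assumes P: "profile y w" and "0 < c" "0 < x"
  shows "w x = w c * exp (A y c - A y x)"
proof -
  have "((\<lambda>x. w x * exp (A y x)) has_real_derivative 0) (at t)" if "0 < t" for t
    by (rule derivative_eq_intros profile_deriv(2)[OF P] A_deriv[OF P] that refl)+
      (simp add: algebra_simps)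
  then have "((\<lambda>x. w x * exp (A y x)) has_real_derivative 0) (at t within {0<..})"
    if "t \<in> {0<..}" for t
    using that by (auto intro: has_field_derivative_at_within)
  then have "\<exists>k. \<forall>t\<in>{0<..}. w t * exp (A y t) = k"
    by (intro has_field_derivative_zero_constant) auto
  then have "w x * exp (A y x) = w c * exp (A y c)"
    using assms by (metis greaterThan_iff)
  then show ?thesis by (simp add: exp_diff field_simps)
qed

lemma profile_tendsto:
  assumes "profile y w" "0 \<le> c" "\<And>x. c \<le> x \<Longrightarrow> y x \<le> b"
  shows "1 \<le> b"
proof (rule tendsto_upperbound)
  show "(y \<longlongrightarrow> 1) at_top" using assms by (simp add: profile_def)
  show "\<forall>\<^sub>F x in at_top. y x \<le> b"
    using eventually_ge_at_top[of c] by eventually_elim (use assms in auto)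
qed simp

text \<open>One negative value would make the flux negative everywhere by
  \<open>flux_formula\<close>; then \<open>y\<close> decreases strictly from values at most 1 and
  cannot tend to 1.\<close>

lemma flux_nonneg:
  assumes P: "profile y w" and "0 < x"
  shows "0 \<le> w x"
proof (rule ccontr)
  assume "\<not> 0 \<le> w x"
  then have neg: "w t < 0" if "0 < t" for t
    using flux_formula[OF P \<open>0 < x\<close> that] by (simp add: mult_neg_pos)
  have dec: "y t < y s" if "0 < s" "s < t" for s t
  proof (rule DERIV_neg_imp_decreasing[OF \<open>s < t\<close>])
    fix r assume "s \<le> r" "r \<le> t"
    then have "0 < r" using that by simp
    then show "\<exists>d. (y has_real_derivative d) (at r) \<and> d < 0"
      using profile_deriv(1)[OF P] neg[of r] profileD(3)[OF P, of r]
      by (intro exI[of _ "w r / a (y r)"]) (auto intro: divide_neg_pos)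
  qed
  have "1 \<le> y 2"
    by (rule profile_tendsto[OF P, of 2]) (use dec[of 2] in \<open>auto simp: le_less\<close>)
  then show False
    using dec[of 1 2] profileD(2)[OF P, of 1] by simp
qed

text \<open>The factor \<open>a (y x)\<close> from the chain rule cancels the denominator.
  \<open>G\<close> is differentiable only relative to [0,1], so the chain rule is applied within the
  image of the open half-line.\<close>

lemma G_profile_deriv:
  assumes P: "profile y w" and "0 < x"
  shows "((\<lambda>x. G (y x)) has_real_derivative w x) (at x)"
proof -
  have *: "(y has_real_derivative w x / a (y x)) (at x within {0<..})"
    using profile_deriv(1)[OF assms] by (rule has_field_derivative_at_within)
  have "(G has_real_derivative a (y x)) (at (y x) within y ` {0<..})"
    by (rule DERIV_subset[OF G_deriv]) (use profileD(1,2)[OF P] assms in auto)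
  from DERIV_image_chain[OF this *]
  have "((\<lambda>x. G (y x)) has_real_derivative a (y x) * (w x / a (y x))) (at x within {0<..})"
    by (simp add: o_def)
  moreover have "a (y x) \<noteq> 0" using profileD(3)[OF P, of x] assms by simp
  ultimately show ?thesis
    using assms by (simp add: at_within_open[of x "{0<..}"])
qed

lemma G_profile_cont:
  assumes P: "profile y w"
  shows "continuous_on {0..} (\<lambda>x. G (y x))"
proof (rule continuous_on_compose2[of "{0..1}" G])
  show "continuous_on {0..1} G"
    by (rule DERIV_continuous_on[OF G_deriv])
qed (use P in \<open>auto simp: profile_def\<close>)

section \<open>Comparison of two profiles\<close>

text \<open>Where \<open>y2\<close> is larger, so is its diffusivity, hence \<open>A y2\<close>
  grows more slowly and \<open>w2\<close> is damped less.\<close>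

lemma flux_le_propagates:
  assumes P: "profile y1 w1" "profile y2 w2" and c: "0 < c" "c \<le> x"
    and le: "\<And>s. c < s \<Longrightarrow> s < x \<Longrightarrow> y1 s \<le> y2 s" and w: "w1 c \<le> w2 c"
  shows "w1 x \<le> w2 x"
proof -
  have D: "((\<lambda>x. A y1 x - A y2 x) has_real_derivative 2 * s / a (y1 s) - 2 * s / a (y2 s)) (at s)"
    if "c \<le> s" for s
    using that c by (intro derivative_intros A_deriv[OF P(1)] A_deriv[OF P(2)]) auto
  have "A y1 c - A y2 c \<le> A y1 x - A y2 x"
  proof (rule DERIV_nonneg_imp_increasing_open[OF \<open>c \<le> x\<close>])
    fix s assume s: "c < s" "s < x"
    have "a (y1 s) \<le> a (y2 s)"
      using s c le profileD[OF P(1), of s] profileD[OF P(2), of s] by (intro mono) auto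
    then have "2 * s / a (y2 s) \<le> 2 * s / a (y1 s)"
      using s c profileD[OF P(1), of s] by (intro divide_left_mono) auto
    then show "\<exists>d. ((\<lambda>x. A y1 x - A y2 x) has_real_derivative d) (at s) \<and> 0 \<le> d"
      using D[of s] s by auto
  next
    show "continuous_on {c..x} (\<lambda>x. A y1 x - A y2 x)"
      by (rule DERIV_continuous_on[OF has_field_derivative_at_within[OF D]]) auto
  qed
  then have e: "exp (A y1 c - A y1 x) \<le> exp (A y2 c - A y2 x)" by simp
  have "w1 x = w1 c * exp (A y1 c - A y1 x)"
    using c by (intro flux_formula[OF P(1)]) auto
  also have "\<dots> \<le> w2 c * exp (A y2 c - A y2 x)"
    using w e flux_nonneg[OF P(2) c(1)] by (intro mult_mono) auto
  also have "\<dots> = w2 x"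
    using c by (intro flux_formula[OF P(2), symmetric]) auto
  finally show ?thesis .
qed

lemma flux_less:
  assumes P: "profile y1 w1" "profile y2 w2" and c: "0 < c" and less: "y1 c < y2 c"
  shows "w2 c < w1 c"
proof (rule ccontr)
  assume "\<not> w2 c < w1 c"
  then have w: "w1 c \<le> w2 c" by simp
  define z where "z x = G (y2 x) - G (y1 x)" for x
  \<comment> \<open>The order is assumed only on the open interval, so that the claim also reaches a
    first crossing point, where the order fails.\<close>
  have inc: "z c \<le> z x" if x: "c \<le> x" and le: "\<And>s. c < s \<Longrightarrow> s < x \<Longrightarrow> y1 s \<le> y2 s" for x
  proof (rule DERIV_nonneg_imp_nondecreasing[OF x])
    fix s assume s: "c \<le> s" "s \<le> x"
    have "w1 s \<le> w2 s"
      by (rule flux_le_propagates[OF P c s(1) _ w]) (use le s in auto)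
    moreover have "(z has_real_derivative w2 s - w1 s) (at s)"
      unfolding z_def using s c
      by (intro derivative_intros G_profile_deriv[OF P(1)] G_profile_deriv[OF P(2)]) auto
    ultimately show "\<exists>d. (z has_real_derivative d) (at s) \<and> 0 \<le> d" by auto
  qed
  have bd: "0 \<le> y1 x" "y1 x \<le> 1" "0 \<le> y2 x" "y2 x \<le> 1" if "c \<le> x" for x
    using profileD(1,2)[OF P(1), of x] profileD(1,2)[OF P(2), of x] that c by auto
  have zc: "0 < z c"
    using G_diff(1)[of "y1 c" "y2 c"] less bd[of c] by (auto simp: z_def)
  have "y1 x < y2 x" if "c \<le> x" for x
  proof (rule ccontr)
    assume n: "\<not> y1 x < y2 x"
    \<comment> \<open>\<open>S\<close> collects the failures of the order on [c,x]. Its least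
      element \<open>e\<close> is the first crossing: \<open>inc\<close> gives \<open>z e\<close>
      \<ge> \<open>z c\<close> > 0 there, while the reversed order gives \<open>z e\<close> \<le>
      0.\<close>
    define S where "S = {s \<in> {c..x}. y2 s \<le> y1 s}"
    have "continuous_on {c..x} y1" "continuous_on {c..x} y2"
      using P c by (auto simp: profile_def intro: continuous_on_subset)
    then have "closed S"
      unfolding S_def by (intro continuous_on_closed_Collect_le) auto
    then have "compact S"
      by (rule compact_eq_bounded_closed[THEN iffD2, OF conjI, rotated])
        (auto simp: S_def intro: bounded_subset[OF bounded_closed_interval[of c x]])
    moreover have "S \<noteq> {}" using n that by (auto simp: S_def)
    ultimately obtain e where e: "e \<in> S" "\<And>s. s \<in> S \<Longrightarrow> e \<le> s"
      using compact_attains_inf by metis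
    have "z c \<le> z e"
    proof (rule inc)
      show "c \<le> e" using e by (simp add: S_def)
      show "y1 s \<le> y2 s" if "c < s" "s < e" for s
        using e(1) e(2)[of s] that by (force simp: S_def)
    qed
    moreover have "z e \<le> 0"
      using G_diff(1)[of "y2 e" "y1 e"] e bd[of e] by (auto simp: z_def S_def)
    ultimately show False using zc by simp
  qed
  then have inc': "z c \<le> z x" if "c \<le> x" for x
    using that by (intro inc) (auto simp: less_imp_le)
  have a1: "0 < a 1" using ge1[of 1] by simp
  \<comment> \<open>A persistent gap in \<open>G\<close> keeps \<open>y1\<close> a fixed distance
    below 1, against its limit.\<close>
  have "y1 x \<le> 1 - z c / a 1" if "c \<le> x" for x
  proof -
    have "z c \<le> G (y2 x) - G (y1 x)" using inc'[OF that] by (simp add: z_def)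
    also have "\<dots> \<le> G 1 - G (y1 x)" using G_diff(1)[of "y2 x" 1] bd[OF that] by simp
    also have "\<dots> \<le> a 1 * (1 - y1 x)" using G_diff(2)[of "y1 x" 1] bd[OF that] by simp
    finally show ?thesis using a1 by (simp add: field_simps)
  qed
  then have "1 \<le> 1 - z c / a 1"
    using c by (intro profile_tendsto[OF P(1), of c]) auto
  then show False using zc a1 by (simp add: field_simps)
qed

lemma comparison:
  assumes P: "profile y1 w1" "profile y2 w2" and x: "0 \<le> x"
  shows "G (y2 x) - G (y1 x) \<le> max 0 (G (y2 0) - G (y1 0))"
proof -
  define z where "z x = G (y2 x) - G (y1 x)" for x
  have "continuous_on {0..x} z"
    unfolding z_def
    by (intro continuous_intros continuous_on_subset[OF G_profile_cont[OF P(1)]]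
        continuous_on_subset[OF G_profile_cont[OF P(2)]]) auto
  then obtain c where c: "c \<in> {0..x}" and max: "\<And>s. s \<in> {0..x} \<Longrightarrow> z s \<le> z c"
    using continuous_attains_sup[of "{0..x}" z] x by (auto simp: compact_Icc)
  have "z c \<le> max 0 (z 0)"
  proof (rule ccontr)
    assume n: "\<not> z c \<le> max 0 (z 0)"
    then have "c \<noteq> 0" by auto
    then have c0: "0 < c" using c by simp
    have "y1 c < y2 c"
    proof (rule ccontr)
      assume "\<not> y1 c < y2 c"
      then show False
        using G_diff(1)[of "y2 c" "y1 c"] n c0 profileD[OF P(1), of c] profileD[OF P(2), of c]
        by (auto simp: z_def)
    qed
    \<comment> \<open>At a positive maximum away from 0, \<open>z\<close> would have negative slope,
      so it is larger just to the left. The left side is used because \<open>c\<close> may be the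
      right endpoint \<open>x\<close>.\<close>
    from flux_less[OF P c0 this] have "w2 c - w1 c < 0" by simp
    moreover have "(z has_real_derivative w2 c - w1 c) (at c)"
      unfolding z_def using c0
      by (intro derivative_intros G_profile_deriv[OF P(1)] G_profile_deriv[OF P(2)]) auto
    ultimately obtain d where d: "d > 0" "\<And>h. 0 < h \<Longrightarrow> h < d \<Longrightarrow> z c < z (c - h)"
      using DERIV_neg_dec_left by blast
    define h where "h = min (d/2) c"
    have "0 < h" "h < d" "c - h \<in> {0..x}"
      using d c c0 by (auto simp: h_def min_def)
    then show False using d(2)[of h] max[of "c - h"] by simp
  qed
  then show ?thesis using max[of x] x by (simp add: z_def)
qed

section \<open>Flux and slope bounds near the origin\<close>

lemma profile_MVT:
  assumes P: "profile y w" and h: "0 < h"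
  obtains s where "0 < s" "s < h" "y h - y 0 = h * (w s / a (y s))"
proof -
  have "continuous_on {0..h} y"
    using P by (auto simp: profile_def intro: continuous_on_subset)
  then have "\<exists>l s. 0 < s \<and> s < h \<and> DERIV y s :> l \<and> y h - y 0 = (h - 0) * l"
    using h profile_deriv(1)[OF P] by (intro MVT) (auto simp: real_differentiable_def)
  then obtain l s where s: "0 < s" "s < h" "DERIV y s :> l" "y h - y 0 = (h - 0) * l"
    by blast
  moreover have "l = w s / a (y s)"
    by (rule DERIV_unique[OF s(3) profile_deriv(1)[OF P s(1)]])
  ultimately show ?thesis using that by simp
qed

text \<open>On [0,1] the mean slope is at most 1, so some interior \<open>r\<close> has
  \<open>w r\<close> \<le> \<open>a 1\<close>. Since \<open>a\<close> \<ge> 1,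
  \<open>w s * exp (s\<^sup>2)\<close> is nondecreasing, which carries the bound back to all smaller
  arguments; \<open>r\<close> < 1 gives the factor \<open>exp 1\<close>.\<close>

lemma flux_bound:
  assumes P: "profile y w"
  obtains r where "0 < r" "\<And>s. 0 < s \<Longrightarrow> s \<le> r \<Longrightarrow> w s \<le> a 1 * exp 1"
proof -
  obtain r where r: "0 < r" "r < 1" "y 1 - y 0 = w r / a (y r)"
    using profile_MVT[OF P, of 1] by auto
  have "w r / a (y r) \<le> 1"
    using r profileD(2)[OF P, of 1] profileD(1)[OF P, of 0] by simp
  then have wr: "w r \<le> a 1"
    using profileD(3,4)[OF P, of r] r by (simp add: field_simps)
  have "w s \<le> a 1 * exp 1" if s: "0 < s" "s \<le> r" for s
  proof -
    have "w s * exp (s\<^sup>2) \<le> w r * exp (r\<^sup>2)"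
    proof (rule DERIV_nonneg_imp_nondecreasing[OF s(2)])
      fix t assume "s \<le> t" "t \<le> r"
      then have t: "0 < t" using s by simp
      have "((\<lambda>t. w t * exp (t\<^sup>2)) has_real_derivative
          2 * t * exp (t\<^sup>2) * w t * (1 - 1 / a (y t))) (at t)"
        by (rule derivative_eq_intros profile_deriv(2)[OF P t] refl)+
          (simp add: algebra_simps)
      moreover have "0 \<le> 1 - 1 / a (y t)"
        using profileD(3)[OF P, of t] t by simp
      then have "0 \<le> 2 * t * exp (t\<^sup>2) * w t * (1 - 1 / a (y t))"
        using t flux_nonneg[OF P t] by (intro mult_nonneg_nonneg) auto
      ultimately show "\<exists>d. ((\<lambda>t. w t * exp (t\<^sup>2)) has_real_derivative d) (at t) \<and> 0 \<le> d"
        by blast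
    qed
    also have "\<dots> \<le> a 1 * exp 1"
      using wr r ge1[of 1] by (intro mult_mono) (auto simp: power_le_one)
    finally have "w s * exp (s\<^sup>2) \<le> a 1 * exp 1" .
    moreover have "w s * 1 \<le> w s * exp (s\<^sup>2)"
      by (intro mult_left_mono flux_nonneg[OF P s(1)]) simp
    ultimately show ?thesis by simp
  qed
  with r(1) show ?thesis by (rule that)
qed

text \<open>A profile says nothing about the flux at 0, so the bound passes through difference
  quotients, each a slope at an interior point, to the one-sided derivative.\<close>

lemma initial_slope_le:
  assumes P: "profile y w" and d: "(y has_real_derivative d) (at 0 within {0..})"
  shows "d \<le> a 1 * exp 1"
proof -
  obtain r where r: "0 < r" "\<And>s. 0 < s \<Longrightarrow> s \<le> r \<Longrightarrow> w s \<le> a 1 * exp 1"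
    using flux_bound[OF P] by blast
  have "((\<lambda>h. (y h - y 0) / (h - 0)) \<longlongrightarrow> d) (at 0 within {0..r})"
    using DERIV_subset[OF d, of "{0..r}"] by (simp add: has_field_derivative_iff)
  moreover have "(y h - y 0) / (h - 0) \<le> a 1 * exp 1" if h: "0 < h" "h < r" for h
  proof -
    obtain s where s: "0 < s" "s < h" "y h - y 0 = h * (w s / a (y s))"
      using profile_MVT[OF P h(1)] by auto
    have "w s / a (y s) \<le> w s / 1"
      using flux_nonneg[OF P s(1)] profileD(3)[OF P, of s] s by (intro divide_left_mono) auto
    then show ?thesis using r(2)[of s] s h by simp
  qed
  then have "\<forall>\<^sub>F h in at 0 within {0..r}. (y h - y 0) / (h - 0) \<le> a 1 * exp 1"
    using r(1) unfolding eventually_at by (intro exI[of _ r]) (auto simp: dist_real_def)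
  ultimately show ?thesis
    by (rule tendsto_upperbound) (use r(1) in \<open>simp add: at_within_Icc_at_right\<close>)
qed

text \<open>\<open>comparison\<close> is used in both orders: since \<open>u\<close> starts at 0,
  one gives \<open>u\<close> \<le> \<open>y\<close>, the other bounds the gap by
  \<open>G (y 0) - G (u 0)\<close>.\<close>

lemma robin_dirichlet_diff:
  assumes P: "profile y w" "profile u v" and u0: "u 0 = 0" and x: "0 \<le> x"
  shows "\<bar>y x - u x\<bar> \<le> a 1 * y 0"
proof -
  have bd: "0 \<le> y x" "y x \<le> 1" "0 \<le> u x" "u x \<le> 1" "0 \<le> y 0" "y 0 \<le> 1"
    using profileD(1,2)[OF P(1)] profileD(1,2)[OF P(2)] x by auto
  have le: "G (u 0) \<le> G (y 0)" "G (y 0) - G (u 0) \<le> a 1 * y 0"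
    using G_diff[of 0 "y 0"] bd u0 by auto
  have "G (y x) - G (u x) \<le> a 1 * y 0" "G (u x) - G (y x) \<le> 0"
    using comparison[OF P(2,1) x] comparison[OF P x] le G_diff(1)[of 0 "y 0"] bd u0 by auto
  then show ?thesis
    using G_diff(1)[of "u x" "y x"] G_diff(1)[of "y x" "u x"] bd by (cases "u x \<le> y x") auto
qed

end

section \<open>The power-law diffusivity and the convergence rate\<close>

lemma diffusivity_powr:
  assumes "1 \<le> p" "0 \<le> \<delta>"
  shows "diffusivity (\<lambda>u. 1 + \<delta> * u powr p)"
proof
  show "continuous_on {0..1} (\<lambda>u. 1 + \<delta> * u powr p)"
    using assms by (intro continuous_intros continuous_on_powr') auto
  show "1 + \<delta> * s powr p \<le> 1 + \<delta> * t powr p" if "0 \<le> s" "s \<le> t" for s t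
    using that assms by (intro add_left_mono mult_left_mono powr_mono2) auto
qed (use assms in auto)

lemma K_set_le_1:
  assumes "h \<in> K_set" "0 \<le> x"
  shows "h x \<le> 1"
proof -
  have "bdd_above ((\<lambda>x. \<bar>h x\<bar>) ` {0..})"
    using assms by (fastforce simp: K_set_def X_space_def bounded_iff bdd_above_def)
  then have "\<bar>h x\<bar> \<le> sup_norm h"
    unfolding sup_norm_def using assms by (intro cSUP_upper) auto
  then show ?thesis using assms by (simp add: K_set_def)
qed

text \<open>The flux is the differentiated quantity of the equation; its coefficient never vanishes,
  so dividing by it recovers \<open>y'\<close>.\<close>

lemma profile_solution:
  assumes p: "1 \<le> p" "0 \<le> \<delta>" and K: "y \<in> K_set" and ode: "solves_ode p \<delta> y y'"
  shows "diffusivity.profile (\<lambda>u. 1 + \<delta> * u powr p) y (\<lambda>x. (1 + \<delta> * y x powr p) * y' x)"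
proof -
  interpret diffusivity "\<lambda>u. 1 + \<delta> * u powr p" by (rule diffusivity_powr[OF p])
  have pos: "1 + \<delta> * y x powr p \<noteq> 0" for x
    using p by (smt (verit) mult_nonneg_nonneg powr_ge_zero)
  have "(y has_real_derivative y' x) (at x)"
    "((\<lambda>s. (1 + \<delta> * y s powr p) * y' s) has_real_derivative - (2 * x * y' x)) (at x)"
    if "0 < x" for x
  proof -
    obtain d where "((\<lambda>s. (1 + \<delta> * y s powr p) * y' s) has_real_derivative d) (at x)"
      "d + 2 * x * y' x = 0"
      using ode \<open>0 < x\<close> unfolding solves_ode_def by blast
    moreover from this have "d = - (2 * x * y' x)" by simp
    ultimately show "((\<lambda>s. (1 + \<delta> * y s powr p) * y' s) has_real_derivative - (2 * x * y' x)) (at x)"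
      by simp
  qed (use ode that in \<open>auto simp: solves_ode_def\<close>)
  then show ?thesis
    using K pos by (auto simp: profile_def K_set_def X_space_def K_set_le_1[OF K] mult.assoc)
qed

theorem theorem3p3:
  fixes p \<delta> :: real and y :: "real \<Rightarrow> real \<Rightarrow> real" and ystar :: "real \<Rightarrow> real"
  assumes "p \<ge> 1"
    and "0 \<le> \<delta>"
    and "\<forall>\<^sub>F \<gamma> in at_top. \<delta> < min (delta_hat p) (delta_gamma p \<gamma>)"
    and "\<forall>\<^sub>F \<gamma> in at_top. y \<gamma> \<in> K_set \<and> robin_solution p \<delta> \<gamma> (y \<gamma>)"
    and "ystar \<in> K_set" and "dirichlet_solution p \<delta> ystar"
  shows "((\<lambda>\<gamma>. sup_norm (\<lambda>x. y \<gamma> x - ystar x)) \<longlongrightarrow> 0) at_top \<and>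
         (\<lambda>\<gamma>. sup_norm (\<lambda>x. y \<gamma> x - ystar x)) \<in> O[at_top](\<lambda>\<gamma>. 1 / \<gamma>)"
proof -
  interpret diffusivity "\<lambda>u. 1 + \<delta> * u powr p" by (rule diffusivity_powr[OF assms(1,2)])
  define N where "N \<gamma> = sup_norm (\<lambda>x. y \<gamma> x - ystar x)" for \<gamma>
  \<comment> \<open>With \<open>a 1\<close> = 1 + \<delta>, one factor comes with
    \<open>exp 1\<close> from the initial slope, one from the coefficient in the Robin condition,
    and one from \<open>robin_dirichlet_diff\<close>.\<close>
  define M where "M = (1 + \<delta>) ^ 3 * exp 1"
  obtain v where v: "solves_ode p \<delta> ystar v" and ystar0: "ystar 0 = 0"
    using assms(6) by (auto simp: dirichlet_solution_def)
  note Pstar = profile_solution[OF assms(1,2,5) v]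
  have bound: "norm (N \<gamma>) \<le> M * norm (1 / \<gamma>)"
    if K: "y \<gamma> \<in> K_set" and rob: "robin_solution p \<delta> \<gamma> (y \<gamma>)" and \<gamma>: "0 < \<gamma>" for \<gamma>
  proof -
    from rob obtain y' where ode: "solves_ode p \<delta> (y \<gamma>) y'"
      and d: "(y \<gamma> has_real_derivative y' 0) (at 0 within {0..})"
      and bc: "(1 + \<delta> * y \<gamma> 0 powr p) * y' 0 = \<gamma> * y \<gamma> 0"
      by (auto simp: robin_solution_def)
    note P = profile_solution[OF assms(1,2) K ode]
    have "\<gamma> * y \<gamma> 0 \<le> (1 + \<delta> * y \<gamma> 0 powr p) * ((1 + \<delta>) * exp 1)"
      unfolding bc[symmetric] using initial_slope_le[OF P d] profileD(3)[OF P, of 0]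
      by (intro mult_left_mono) auto
    also have "\<dots> \<le> (1 + \<delta>) * ((1 + \<delta>) * exp 1)"
      using profileD(4)[OF P, of 0] assms(2) by (intro mult_right_mono) auto
    finally have y0: "y \<gamma> 0 \<le> (1 + \<delta>) * ((1 + \<delta>) * exp 1) / \<gamma>"
      using \<gamma> by (simp add: field_simps)
    have diff: "\<bar>y \<gamma> x - ystar x\<bar> \<le> M / \<gamma>" if "0 \<le> x" for x
    proof -
      have "\<bar>y \<gamma> x - ystar x\<bar> \<le> (1 + \<delta>) * y \<gamma> 0"
        using robin_dirichlet_diff[OF P Pstar ystar0 that] by simp
      also have "\<dots> \<le> (1 + \<delta>) * ((1 + \<delta>) * ((1 + \<delta>) * exp 1) / \<gamma>)"
        using y0 assms(2) by (intro mult_left_mono) auto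
      finally show ?thesis by (simp add: M_def power3_eq_cube mult_ac)
    qed
    then have "N \<gamma> \<le> M / \<gamma>"
      unfolding N_def sup_norm_def by (intro cSUP_least) auto
    moreover have "\<bar>y \<gamma> 0 - ystar 0\<bar> \<le> N \<gamma>"
      unfolding N_def sup_norm_def
      by (rule cSUP_upper[where f = "\<lambda>x. \<bar>y \<gamma> x - ystar x\<bar>"])
        (use diff in \<open>auto simp: bdd_above_def\<close>)
    ultimately show ?thesis using \<gamma> by simp
  qed
  have ev: "\<forall>\<^sub>F \<gamma> in at_top. norm (N \<gamma>) \<le> M * norm (1 / \<gamma>)"
    using assms(4) eventually_gt_at_top[of 0] by eventually_elim (use bound in auto)
  have "((\<lambda>\<gamma>::real. 1 / \<gamma>) \<longlongrightarrow> 0) at_top"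
    by (intro tendsto_divide_0[OF tendsto_const] filterlim_at_top_imp_at_infinity filterlim_ident)
  then have "((\<lambda>\<gamma>::real. M * norm (1 / \<gamma>)) \<longlongrightarrow> 0) at_top"
    by (intro tendsto_mult_right_zero tendsto_norm_zero)
  with ev have "(N \<longlongrightarrow> 0) at_top" by (rule Lim_null_comparison)
  moreover have "N \<in> O[at_top](\<lambda>\<gamma>. 1 / \<gamma>)" using ev by (rule bigoI)
  ultimately show ?thesis by (simp add: N_def[abs_def])
qed

end
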